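(* Let $Q=(q_{ij})$ be a real symmetric $n\times n$ matrix with zero diagonal, $c\in\mathbb{R}^n$, $R_i=\{j:q_{ij}\neq0\}$, $R^-_i=\{j:q_{ij}<0\}$, and let $\alpha_{ij}>0$ for $j\in R^-_i$, $i=1,\dots,n$. Consider the MILP ORDW($\alpha$) in variables $x_i$ and $y_{ij}$ ($j\in R_i$): maximize $\sum_{i=1}^n\sum_{j\in R_i}q_{ij}y_{ij}+\sum_{i=1}^n c_ix_i$ subject to $\sum_{j\in R^-_i}\alpha_{ij}(x_j-y_{ij})\le\left(\sum_{j\in R^-_i}\alpha_{ij}\right)(1-x_i)$ for $i=1,\dots,n$; $2y_{ij}-x_i-x_j\le 0$ for all $j\in R_i$, $i=1,\dots,n$; $x_i\in\{0,1\}$ for all $i$; $y_{ij}\in\{0,1\}$ for all $j\in R_i$, $i=1,\dots,n$. Then ORDW($\alpha$) is a valid formulation of QUBO.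
   Context: QUBO is the problem: maximize $\sum_{i=1}^n\sum_{j\in R_i}q_{ij}x_ix_j+\sum_{i=1}^n c_ix_i$ over $x\in\{0,1\}^n$. An MILP in variables $(x,y)$ with objective $\sum_i\sum_{j\in R_i}q_{ij}y_{ij}+\sum_i c_ix_i$ is a valid formulation of QUBO if its optimal objective value equals the optimal value of QUBO and the $x$-part of every optimal solution of the MILP is an optimal solution of QUBO (the variables $y_{ij}$ need only equal $x_ix_j$ at optimal solutions). *)

theory Defs
  imports "HOL-Analysis.Analysis"
begin

definition has_opt_value :: "('a \<Rightarrow> real) \<Rightarrow> ('a \<Rightarrow> bool) \<Rightarrow> real \<Rightarrow> bool" where
  "has_opt_value f P v \<longleftrightarrow> (\<exists>z. is_arg_max f P z \<and> f z = v)"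

definition R :: "real^'n^'n \<Rightarrow> 'n \<Rightarrow> 'n set" where
  "R Q i = {j. Q $ i $ j \<noteq> 0}"

definition Rneg :: "real^'n^'n \<Rightarrow> 'n \<Rightarrow> 'n set" where
  "Rneg Q i = {j. Q $ i $ j < 0}"

definition qubo_feasible :: "real^'n \<Rightarrow> bool" where
  "qubo_feasible x \<longleftrightarrow> (\<forall>i. x $ i \<in> {0, 1})"

definition qubo_obj :: "real^'n^'n \<Rightarrow> real^'n \<Rightarrow> real^'n \<Rightarrow> real" where
  "qubo_obj Q c x = (\<Sum>i\<in>UNIV. \<Sum>j\<in>R Q i. Q $ i $ j * x $ i * x $ j) + (\<Sum>i\<in>UNIV. c $ i * x $ i)"

definition milp_obj :: "real^'n^'n \<Rightarrow> real^'n \<Rightarrow> (real^'n) \<times> ('n \<times> 'n \<Rightarrow> real) \<Rightarrow> real" where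
  "milp_obj Q c = (\<lambda>(x, y).
     (\<Sum>i\<in>UNIV. \<Sum>j\<in>R Q i. Q $ i $ j * y (i, j)) + (\<Sum>i\<in>UNIV. c $ i * x $ i))"

text \<open>
  A formulation is given by its feasibility predicate; its objective is always \<open>milp_obj\<close>.
  The variables \<open>y (i, j)\<close> need not equal \<open>x $ i * x $ j\<close> at feasible points.
  The first conjunct includes that both optimal values are attained.
\<close>

definition valid_formulation ::
    "real^'n^'n \<Rightarrow> real^'n \<Rightarrow> ((real^'n) \<times> ('n \<times> 'n \<Rightarrow> real) \<Rightarrow> bool) \<Rightarrow> bool" where
  "valid_formulation Q c F \<longleftrightarrow>
     (\<exists>v. has_opt_value (milp_obj Q c) F v \<and> has_opt_value (qubo_obj Q c) qubo_feasible v) \<and>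
     (\<forall>x y. is_arg_max (milp_obj Q c) F (x, y) \<longrightarrow> is_arg_max (qubo_obj Q c) qubo_feasible x)"

text \<open>
  There is a variable \<open>y (i, j)\<close> only for \<open>j \<in> R Q i\<close>: the extensional function space fixes
  \<open>y\<close> to \<open>undefined\<close> on all other pairs.
\<close>

definition ordw_feasible ::
    "real^'n^'n \<Rightarrow> ('n \<Rightarrow> 'n \<Rightarrow> real) \<Rightarrow> (real^'n) \<times> ('n \<times> 'n \<Rightarrow> real) \<Rightarrow> bool" where
  "ordw_feasible Q \<alpha> = (\<lambda>(x, y).
     (\<forall>i. (\<Sum>j\<in>Rneg Q i. \<alpha> i j * (x $ j - y (i, j))) \<le> (\<Sum>j\<in>Rneg Q i. \<alpha> i j) * (1 - x $ i)) \<and>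
     (\<forall>i. \<forall>j\<in>R Q i. 2 * y (i, j) - x $ i - x $ j \<le> 0) \<and>
     (\<forall>i. x $ i \<in> {0, 1}) \<and>
     y \<in> (SIGMA i:UNIV. R Q i) \<rightarrow>\<^sub>E {0, 1})"

end

theory Submission
  imports Defs
begin

text \<open>
  For binary values, the constraint \<open>2 y\<^sub>i\<^sub>j - x\<^sub>i - x\<^sub>j \<le> 0\<close> says \<open>y\<^sub>i\<^sub>j \<le> x\<^sub>i x\<^sub>j\<close>. Hence, if \<open>x\<^sub>i = 1\<close>, all
  summands of the aggregated constraint of row \<open>i\<close> are nonnegative while their sum is at most \<open>0\<close>,
  which forces \<open>y\<^sub>i\<^sub>j = x\<^sub>i x\<^sub>j\<close> whenever \<open>q\<^sub>i\<^sub>j < 0\<close>. So the MILP objective never exceeds the QUBO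
  objective at \<open>x\<close>, and the feasible choice \<open>y\<^sub>i\<^sub>j = x\<^sub>i x\<^sub>j\<close> attains it.
\<close>

lemma finite_qubo_feasible: "finite {x :: real^'n. qubo_feasible x}"
proof (rule finite_subset)
  show "{x :: real^'n. qubo_feasible x} \<subseteq> vec_lambda ` (UNIV \<rightarrow>\<^sub>E {0, 1})"
  proof
    fix x :: "real^'n" assume "x \<in> {x. qubo_feasible x}"
    then have "vec_nth x \<in> UNIV \<rightarrow>\<^sub>E {0, 1}"
      by (auto simp: qubo_feasible_def PiE_UNIV_domain)
    then show "x \<in> vec_lambda ` (UNIV \<rightarrow>\<^sub>E {0, 1})"
      by (metis image_eqI vec_nth_inverse)
  qed
  show "finite (vec_lambda ` (UNIV \<rightarrow>\<^sub>E {0, 1 :: real}) :: (real^'n) set)"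
    by (intro finite_imageI finite_PiE) auto
qed

lemma ex_qubo_optimum: "\<exists>x. is_arg_max (qubo_obj Q c) qubo_feasible x"
proof -
  let ?V = "qubo_obj Q c ` {x. qubo_feasible x}"
  have fin: "finite ?V"
    using finite_qubo_feasible by (rule finite_imageI)
  \<comment> \<open>The zero vector makes the finite set of objective values nonempty, so that its
    \<open>Max\<close> is attained.\<close>
  have "qubo_feasible 0"
    by (simp add: qubo_feasible_def)
  then have "Max ?V \<in> ?V"
    using fin by (intro Max_in) auto
  then obtain x where "qubo_feasible x" "qubo_obj Q c x = Max ?V"
    by auto
  then have "is_arg_max (qubo_obj Q c) qubo_feasible x"
    using fin by (auto simp: is_arg_max_linorder)
  then show ?thesis
    by blast
qed

text \<open>Reduces validity to a comparison for each fixed \<open>x\<close>: by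
  \<open>upper\<close> and \<open>lift\<close>, maximizing over \<open>y\<close> alone yields
  exactly the QUBO objective at \<open>x\<close>, so projecting to \<open>x\<close> preserves
  optimal values and maximizers.\<close>

lemma valid_formulationI:
  assumes feasible: "\<And>x y. F (x, y) \<Longrightarrow> qubo_feasible x"
    and upper: "\<And>x y. F (x, y) \<Longrightarrow> milp_obj Q c (x, y) \<le> qubo_obj Q c x"
    and lift: "\<And>x. qubo_feasible x \<Longrightarrow> \<exists>y. F (x, y) \<and> milp_obj Q c (x, y) = qubo_obj Q c x"
  shows "valid_formulation Q c F"
proof -
  obtain x where x: "is_arg_max (qubo_obj Q c) qubo_feasible x"
    using ex_qubo_optimum by blast
  then have x_max: "qubo_obj Q c x' \<le> qubo_obj Q c x" if "qubo_feasible x'" for x'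
    using that by (auto simp: is_arg_max_linorder)
  obtain y where y: "F (x, y)" "milp_obj Q c (x, y) = qubo_obj Q c x"
    using lift x by (auto simp: is_arg_max_def)
  have "milp_obj Q c z \<le> qubo_obj Q c x" if "F z" for z
    using that feasible upper x_max by (cases z) (metis order_trans)
  then have "is_arg_max (milp_obj Q c) F (x, y)"
    using y by (simp add: is_arg_max_linorder)
  moreover have "is_arg_max (qubo_obj Q c) qubo_feasible x'"
    if "is_arg_max (milp_obj Q c) F (x', y')" for x' y'
  proof -
    have F: "F (x', y')" and le: "milp_obj Q c (x, y) \<le> milp_obj Q c (x', y')"
      using that y(1) by (auto simp: is_arg_max_linorder)
    \<comment> \<open>The lifted optimum \<open>(x, y)\<close> is a competitor of
      \<open>(x', y')\<close>, and \<open>upper\<close> bounds the MILP value at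
      \<open>(x', y')\<close> by the QUBO value at \<open>x'\<close>.\<close>
    then have "qubo_obj Q c x \<le> qubo_obj Q c x'"
      using y(2) upper by force
    then show ?thesis
      using F feasible x_max by (force simp: is_arg_max_linorder)
  qed
  ultimately show ?thesis
    using x y(2) unfolding valid_formulation_def has_opt_value_def by blast
qed

text \<open>Integrality of \<open>y\<close> is decisive: if exactly one of \<open>x $ i\<close> and
  \<open>x $ j\<close> is 1, the constraint only gives \<open>y (i, j) \<le> 1/2\<close>, which
  forces a binary value down to 0.\<close>

lemma ordw_feasible_le_product:
  assumes F: "ordw_feasible Q \<alpha> (x, y)" and j: "j \<in> R Q i"
  shows "y (i, j) \<le> x $ i * x $ j"
proof -
  have "2 * y (i, j) - x $ i - x $ j \<le> 0"
    using F j by (simp add: ordw_feasible_def)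
  moreover have "x $ i \<in> {0, 1}" "x $ j \<in> {0, 1}"
    using F by (simp_all add: ordw_feasible_def)
  moreover have "y (i, j) \<in> {0, 1}"
    using F j by (auto simp: ordw_feasible_def dest: PiE_mem)
  ultimately show ?thesis
    by auto
qed

lemma ordw_feasible_eq_product:
  assumes F: "ordw_feasible Q \<alpha> (x, y)"
    and pos: "\<And>k. k \<in> Rneg Q i \<Longrightarrow> \<alpha> i k > 0"
    and j: "j \<in> Rneg Q i"
  shows "y (i, j) = x $ i * x $ j"
proof -
  have R: "k \<in> R Q i" if "k \<in> Rneg Q i" for k
    using that by (auto simp: R_def Rneg_def)
  have le: "y (i, k) \<le> x $ i * x $ k" if "k \<in> Rneg Q i" for k
    using ordw_feasible_le_product[OF F R[OF that]] .
  have "x $ i = 0 \<or> x $ i = 1"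
    using F by (simp add: ordw_feasible_def)
  then show ?thesis
  proof
    \<comment> \<open>The product is 0 here, so the upper bound meets
      \<open>y (i, j) \<ge> 0\<close>.\<close>
    assume "x $ i = 0"
    moreover have "y (i, j) \<in> {0, 1}"
      using F R[OF j] by (auto simp: ordw_feasible_def dest: PiE_mem)
    ultimately show ?thesis
      using le[OF j] by auto
  next
    assume i: "x $ i = 1"
    let ?t = "\<lambda>k. \<alpha> i k * (x $ k - y (i, k))"
    have nonneg: "0 \<le> ?t k" if "k \<in> Rneg Q i" for k
      using le[OF that] pos[OF that] i by simp
    have "sum ?t (Rneg Q i) \<le> (\<Sum>k\<in>Rneg Q i. \<alpha> i k) * (1 - x $ i)"
      using F by (simp add: ordw_feasible_def)
    then have "sum ?t (Rneg Q i) = 0"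
      using i sum_nonneg[of "Rneg Q i" ?t] nonneg by simp
    \<comment> \<open>A vanishing sum of nonnegative terms vanishes termwise; strict positivity of
      the weight then allows cancelling it.\<close>
    then have "?t j = 0"
      using j nonneg by (subst (asm) sum_nonneg_eq_0_iff) auto
    then show ?thesis
      using pos[OF j] i by simp
  qed
qed

text \<open>The comparison is termwise. A negative coefficient would reverse
  \<open>y (i, j) \<le> x $ i * x $ j\<close>, so equality is used there; elsewhere the inequality
  suffices.\<close>

lemma ordw_feasible_milp_obj_le:
  assumes F: "ordw_feasible Q \<alpha> (x, y)"
    and pos: "\<And>i j. j \<in> Rneg Q i \<Longrightarrow> \<alpha> i j > 0"
  shows "milp_obj Q c (x, y) \<le> qubo_obj Q c x"
proof -
  have "Q $ i $ j * y (i, j) \<le> Q $ i $ j * x $ i * x $ j" if j: "j \<in> R Q i" for i j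
  proof (cases "j \<in> Rneg Q i")
    case True
    then show ?thesis
      using ordw_feasible_eq_product[OF F pos True] by simp
  next
    case False
    then have "Q $ i $ j \<ge> 0"
      by (simp add: Rneg_def)
    then show ?thesis
      using ordw_feasible_le_product[OF F j] by (simp add: mult.assoc mult_left_mono)
  qed
  then show ?thesis
    by (auto simp: milp_obj_def qubo_obj_def intro!: sum_mono)
qed

lemma ordw_feasible_product:
  assumes x: "qubo_feasible x"
    and pos: "\<And>i j. j \<in> Rneg Q i \<Longrightarrow> \<alpha> i j > 0"
  shows "ordw_feasible Q \<alpha>
    (x, restrict (\<lambda>(i, j). x $ i * x $ j) (SIGMA i:UNIV. R Q i))"
    (is "ordw_feasible Q \<alpha> (x, ?y)")
proof -
  have bin: "x $ i = 0 \<or> x $ i = 1" for i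
    using x by (simp add: qubo_feasible_def)
  have y: "?y (i, j) = x $ i * x $ j" if "j \<in> R Q i" for i j
    using that by simp
  have "(\<Sum>j\<in>Rneg Q i. \<alpha> i j * (x $ j - ?y (i, j))) \<le> (\<Sum>j\<in>Rneg Q i. \<alpha> i j) * (1 - x $ i)" for i
    unfolding sum_distrib_right
  proof (rule sum_mono)
    fix j assume j: "j \<in> Rneg Q i"
    then have "?y (i, j) = x $ i * x $ j"
      by (intro y) (auto simp: R_def Rneg_def)
    \<comment> \<open>The left side is \<open>x $ j * (1 - x $ i)\<close> with
      \<open>x $ j \<le> 1\<close>, so the row constraint already holds term by term.\<close>
    then have "x $ j - ?y (i, j) \<le> 1 - x $ i"
      using bin[of i] bin[of j] by auto
    then show "\<alpha> i j * (x $ j - ?y (i, j)) \<le> \<alpha> i j * (1 - x $ i)"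
      using pos[OF j] by (intro mult_left_mono) auto
  qed
  moreover have "2 * ?y (i, j) - x $ i - x $ j \<le> 0" if "j \<in> R Q i" for i j
    unfolding y[OF that] using bin[of i] bin[of j] by auto
  moreover have "?y \<in> (SIGMA i:UNIV. R Q i) \<rightarrow>\<^sub>E {0, 1}"
    using bin by (auto simp: Pi_iff) (metis mult_1)
  ultimately show ?thesis
    using bin unfolding ordw_feasible_def by simp
qed

theorem theorem13:
  fixes Q :: "real^'n^'n" and c :: "real^'n" and \<alpha> :: "'n \<Rightarrow> 'n \<Rightarrow> real"
  assumes "transpose Q = Q"
    and "\<And>i. Q $ i $ i = 0"
    and "\<And>i j. j \<in> Rneg Q i \<Longrightarrow> \<alpha> i j > 0"
  shows "valid_formulation Q c (ordw_feasible Q \<alpha>)"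
proof (rule valid_formulationI)
  fix x y assume F: "ordw_feasible Q \<alpha> (x, y)"
  then show "qubo_feasible x"
    by (simp add: ordw_feasible_def qubo_feasible_def)
  show "milp_obj Q c (x, y) \<le> qubo_obj Q c x"
    using F assms(3) by (rule ordw_feasible_milp_obj_le)
next
  fix x :: "real^'n" assume x: "qubo_feasible x"
  let ?y = "restrict (\<lambda>(i, j). x $ i * x $ j) (SIGMA i:UNIV. R Q i)"
  \<comment> \<open>The objective reads \<open>?y\<close> only at pairs with
    \<open>j \<in> R Q i\<close>, where the restriction equals the product.\<close>
  have "milp_obj Q c (x, ?y) = qubo_obj Q c x"
    by (simp add: milp_obj_def qubo_obj_def mult.assoc)
  then show "\<exists>y. ordw_feasible Q \<alpha> (x, y) \<and> milp_obj Q c (x, y) = qubo_obj Q c x"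
    using ordw_feasible_product[OF x, of Q \<alpha>] assms(3) by blast
qed

end
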